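(* For every integer $\ell \ge 1$, $r(\ell) \le q(\ell) \le r(\ell) + 1$.
   Context: Let $\tau_{\mathsf{ord}} = \langle <; \mathsf{min}, \mathsf{max}\rangle$ with $<$ binary and $\mathsf{min},\mathsf{max}$ constants. For $\ell \ge 1$, $L_\ell$ denotes the $\tau_{\mathsf{ord}}$-structure interpreting $<$ as a strict linear order on $\ell+1$ elements, with $\mathsf{min}$ and $\mathsf{max}$ the first and last elements; $\ell$ is called its length. $L_{\le \ell}$ is the set $\{L_1,\dots,L_\ell\}$ and $L_{>\ell}$ is the set $\{L_m : m > \ell\}$. A first-order sentence separates a set $\mathcal{A}$ from a set $\mathcal{B}$ of structures if it is true in every structure of $\mathcal{A}$ and false in every structure of $\mathcal{B}$. $r(\ell)$ is the minimum quantifier rank, and $q(\ell)$ the minimum number of quantifier occurrences, of a first-order $\tau_{\mathsf{ord}}$-sentence separating $L_{\le \ell}$ from $L_{>\ell}$. *)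

theory Defs
  imports Main
begin

datatype ord_term = Var nat | MinC | MaxC

datatype ord_fm =
    Eq ord_term ord_term
  | Lt ord_term ord_term
  | Neg ord_fm
  | Conj ord_fm ord_fm
  | Disj ord_fm ord_fm
  | Imp ord_fm ord_fm
  | Ex nat ord_fm
  | All nat ord_fm

fun term_vars :: "ord_term \<Rightarrow> nat set" where
  "term_vars (Var x) = {x}"
| "term_vars MinC = {}"
| "term_vars MaxC = {}"

fun free_vars :: "ord_fm \<Rightarrow> nat set" where
  "free_vars (Eq s t) = term_vars s \<union> term_vars t"
| "free_vars (Lt s t) = term_vars s \<union> term_vars t"
| "free_vars (Neg p) = free_vars p"
| "free_vars (Conj p q) = free_vars p \<union> free_vars q"
| "free_vars (Disj p q) = free_vars p \<union> free_vars q"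
| "free_vars (Imp p q) = free_vars p \<union> free_vars q"
| "free_vars (Ex x p) = free_vars p - {x}"
| "free_vars (All x p) = free_vars p - {x}"

definition sentence :: "ord_fm \<Rightarrow> bool" where
  "sentence p \<longleftrightarrow> free_vars p = {}"

fun quantifier_rank :: "ord_fm \<Rightarrow> nat" where
  "quantifier_rank (Eq s t) = 0"
| "quantifier_rank (Lt s t) = 0"
| "quantifier_rank (Neg p) = quantifier_rank p"
| "quantifier_rank (Conj p q) = max (quantifier_rank p) (quantifier_rank q)"
| "quantifier_rank (Disj p q) = max (quantifier_rank p) (quantifier_rank q)"
| "quantifier_rank (Imp p q) = max (quantifier_rank p) (quantifier_rank q)"
| "quantifier_rank (Ex x p) = Suc (quantifier_rank p)"
| "quantifier_rank (All x p) = Suc (quantifier_rank p)"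

fun quantifier_count :: "ord_fm \<Rightarrow> nat" where
  "quantifier_count (Eq s t) = 0"
| "quantifier_count (Lt s t) = 0"
| "quantifier_count (Neg p) = quantifier_count p"
| "quantifier_count (Conj p q) = quantifier_count p + quantifier_count q"
| "quantifier_count (Disj p q) = quantifier_count p + quantifier_count q"
| "quantifier_count (Imp p q) = quantifier_count p + quantifier_count q"
| "quantifier_count (Ex x p) = Suc (quantifier_count p)"
| "quantifier_count (All x p) = Suc (quantifier_count p)"

record 'a ord_structure =
  universe :: "'a set"
  lt_rel :: "'a \<Rightarrow> 'a \<Rightarrow> bool"
  min_elem :: 'a
  max_elem :: 'a

fun term_val :: "'a ord_structure \<Rightarrow> (nat \<Rightarrow> 'a) \<Rightarrow> ord_term \<Rightarrow> 'a" where
  "term_val S e (Var x) = e x"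
| "term_val S e MinC = min_elem S"
| "term_val S e MaxC = max_elem S"

fun sat :: "'a ord_structure \<Rightarrow> (nat \<Rightarrow> 'a) \<Rightarrow> ord_fm \<Rightarrow> bool" where
  "sat S e (Eq s t) \<longleftrightarrow> term_val S e s = term_val S e t"
| "sat S e (Lt s t) \<longleftrightarrow> lt_rel S (term_val S e s) (term_val S e t)"
| "sat S e (Neg p) \<longleftrightarrow> \<not> sat S e p"
| "sat S e (Conj p q) \<longleftrightarrow> sat S e p \<and> sat S e q"
| "sat S e (Disj p q) \<longleftrightarrow> sat S e p \<or> sat S e q"
| "sat S e (Imp p q) \<longleftrightarrow> (sat S e p \<longrightarrow> sat S e q)"
| "sat S e (Ex x p) \<longleftrightarrow> (\<exists>a\<in>universe S. sat S (e(x := a)) p)"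
| "sat S e (All x p) \<longleftrightarrow> (\<forall>a\<in>universe S. sat S (e(x := a)) p)"

text \<open>For a sentence the choice of the assignment is immaterial, and universes are nonempty.\<close>

definition holds_in :: "'a ord_structure \<Rightarrow> ord_fm \<Rightarrow> bool" where
  "holds_in S p \<longleftrightarrow> (\<forall>e. range e \<subseteq> universe S \<longrightarrow> sat S e p)"

definition separates :: "ord_fm \<Rightarrow> 'a ord_structure set \<Rightarrow> 'a ord_structure set \<Rightarrow> bool" where
  "separates p A B \<longleftrightarrow> (\<forall>S\<in>A. holds_in S p) \<and> (\<forall>S\<in>B. \<not> holds_in S p)"

text \<open>The length \<open>l\<close> is one less than the number of elements.\<close>

definition lin_ord :: "nat \<Rightarrow> nat ord_structure" where
  "lin_ord l = \<lparr>universe = {0..l}, lt_rel = (<), min_elem = 0, max_elem = l\<rparr>"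

definition lin_ords_upto :: "nat \<Rightarrow> nat ord_structure set" where
  "lin_ords_upto l = lin_ord ` {1..l}"

definition lin_ords_above :: "nat \<Rightarrow> nat ord_structure set" where
  "lin_ords_above l = lin_ord ` {l<..}"

text \<open>A separating sentence always exists, since a sentence can bound the number of elements
  by \<open>l + 1\<close>; so both minima range over nonempty sets.\<close>

definition min_rank :: "nat \<Rightarrow> nat" where
  "min_rank l = (LEAST k. \<exists>p. sentence p \<and> separates p (lin_ords_upto l) (lin_ords_above l)
                              \<and> quantifier_rank p = k)"

definition min_count :: "nat \<Rightarrow> nat" where
  "min_count l = (LEAST k. \<exists>p. sentence p \<and> separates p (lin_ords_upto l) (lin_ords_above l)
                               \<and> quantifier_count p = k)"

end

theory Submission
  imports Defs
begin

text \<open>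
  For the lower bound on the rank, an Ehrenfeucht--Fraisse argument with distances capped at
  \<open>2^k\<close> shows that rank \<open>k\<close> cannot tell \<open>L\<^sub>l\<close> from \<open>L\<^sub>l\<^sub>+\<^sub>1\<close> when \<open>2^k \<le> l\<close>; hence
  \<open>l < 2^r(l)\<close>. For the upper bound on the count, "length at most \<open>l\<close>" is expressed by a prenex
  sentence with alternating quantifiers. A universally quantified point splits an interval into
  two parts, one of which must be short; an existentially quantified point splits an interval into
  two parts, both of which must be short. Either way the bound doubles, and the position
  of the newly quantified point among the older ones tells, without quantifiers, which interval has
  been split, so a single quantifier prefix serves all intervals at once.
\<close>

section \<open>The rank lower bound\<close>

lemma term_val_cong:
  assumes "\<forall>x\<in>term_vars t. e x = e' x"
  shows "term_val S e t = term_val S e' t"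
  using assms by (cases t) auto

lemma sat_cong:
  assumes "\<forall>x\<in>free_vars p. e x = e' x"
  shows "sat S e p = sat S e' p"
  using assms
proof (induction p arbitrary: e e')
  case (Eq s t)
  then show ?case using term_val_cong[of s e e' S] term_val_cong[of t e e' S] by simp
next
  case (Lt s t)
  then show ?case using term_val_cong[of s e e' S] term_val_cong[of t e e' S] by simp
next
  case (Neg p)
  then show ?case by (metis free_vars.simps(3) sat.simps(3))
next
  case (Conj p q)
  then have "sat S e p = sat S e' p" "sat S e q = sat S e' q" by simp_all
  then show ?case by simp
next
  case (Disj p q)
  then have "sat S e p = sat S e' p" "sat S e q = sat S e' q" by simp_all
  then show ?case by simp
next
  case (Imp p q)
  then have "sat S e p = sat S e' p" "sat S e q = sat S e' q" by simp_all
  then show ?case by simp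
next
  case (Ex x p)
  then have "sat S (e(x := a)) p = sat S (e'(x := a)) p" for a by simp
  then show ?case by simp
next
  case (All x p)
  then have "sat S (e(x := a)) p = sat S (e'(x := a)) p" for a by simp
  then show ?case by simp
qed

lemma holds_in_sentence:
  assumes "sentence p" "range e \<subseteq> universe S"
  shows "holds_in S p \<longleftrightarrow> sat S e p"
  using assms sat_cong[of p _ e S] unfolding holds_in_def sentence_def by blast

section \<open>The Ehrenfeucht-Fraisse game on finite linear orders\<close>

lemma universe_lin_ord [simp]: "universe (lin_ord N) = {0..N}"
  and lt_rel_lin_ord [simp]: "lt_rel (lin_ord N) = (<)"
  and min_elem_lin_ord [simp]: "min_elem (lin_ord N) = 0"
  and max_elem_lin_ord [simp]: "max_elem (lin_ord N) = N"
  by (simp_all add: lin_ord_def)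

lemma term_val_le:
  assumes "range e \<subseteq> {0..N}"
  shows "term_val (lin_ord N) e t \<le> N"
  using assms by (cases t) (auto simp: image_subset_iff)

text \<open>Truncated subtraction makes the condition decide the order of the two terms as well.\<close>

definition same_capped_diffs :: "nat \<Rightarrow> nat \<Rightarrow> nat \<Rightarrow> (nat \<Rightarrow> nat) \<Rightarrow> (nat \<Rightarrow> nat) \<Rightarrow> bool" where
  "same_capped_diffs K N M e f \<longleftrightarrow>
    (\<forall>s t. min K (term_val (lin_ord N) e t - term_val (lin_ord N) e s)
         = min K (term_val (lin_ord M) f t - term_val (lin_ord M) f s))"

lemma same_capped_diffs_sym: "same_capped_diffs K N M e f \<Longrightarrow> same_capped_diffs K M N f e"
  by (simp add: same_capped_diffs_def)

text \<open>A summand that reaches \<open>K\<close> on one side does so on the other, and then both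
  sums are capped; otherwise the summands agree exactly. The second cap is \<open>2 * K\<close>
  because distances between old points are known to that precision.\<close>

lemma capped_add:
  fixes K :: nat
  assumes "min K x = min K y" "min (2 * K) x' = min (2 * K) y'"
  shows "min K (x + x') = min K (y + y')"
  using assms by (auto simp: min_def split: if_splits)

text \<open>This is Duplicator's reply inside one gap. A side shorter than \<open>K\<close> is
  copied exactly. If both sides reach \<open>K\<close>, then both gaps are at least
  \<open>2 * K\<close> long, and the reply at distance \<open>K\<close> from the left end leaves at
  least \<open>K\<close> on the right.\<close>

lemma split_capped_interval:
  fixes a p q p' q' K :: nat
  assumes "p \<le> a" "a \<le> q" "min (2 * K) (q - p) = min (2 * K) (q' - p')" "p' \<le> q'"
  shows "\<exists>b. p' \<le> b \<and> b \<le> q' \<and> min K (a - p) = min K (b - p') \<and> min K (q - a) = min K (q' - b)"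
proof -
  obtain c d g where a: "a = p + c" and q: "q = p + c + d" and q': "q' = p' + g"
    using assms(1,2,4) by (auto simp: le_iff_add)
  have g: "min (2 * K) (c + d) = min (2 * K) g" using assms(3) by (simp add: q q' add.assoc)
  have "\<exists>h\<le>g. min K c = min K h \<and> min K d = min K (g - h)"
  proof (cases "c < K")
    case True
    then show ?thesis using g by (intro exI[of _ c]) (auto simp: min_def split: if_splits)
  next
    case c: False
    show ?thesis
    proof (cases "d < K")
      case True
      then show ?thesis using g c by (intro exI[of _ "g - d"]) (auto simp: min_def split: if_splits)
    next
      case False
      then show ?thesis using g c by (intro exI[of _ K]) (auto simp: min_def split: if_splits)
    qed
  qed
  then obtain h where "h \<le> g" "min K c = min K h" "min K d = min K (g - h)" by blast
  then show ?thesis by (intro exI[of _ "p' + h"]) (simp add: a q q')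
qed

text \<open>One round of the game costs half of the cap. The new point is enclosed by its nearest
  old values, the reply is placed in the corresponding gap, and distances to farther values follow
  by addition.\<close>

lemma same_capped_diffs_extend:
  assumes K: "K \<ge> 1" and same: "same_capped_diffs (2 * K) N M e f"
    and e: "range e \<subseteq> {0..N}" and f: "range f \<subseteq> {0..M}" and a: "a \<le> N"
  shows "\<exists>b\<le>M. same_capped_diffs K N M (e(x := a)) (f(x := b))"
proof -
  let ?v = "term_val (lin_ord N) e" and ?w = "term_val (lin_ord M) f"
  have same': "min (2 * K) (?v t - ?v s) = min (2 * K) (?w t - ?w s)" for s t
    using same unfolding same_capped_diffs_def by blast
  have vN: "?v t \<le> N" for t using term_val_le[OF e] .
  have wM: "?w t \<le> M" for t using term_val_le[OF f] .
  have fin: "finite {v \<in> range ?v. P v}" for P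
    by (rule finite_subset[of _ "{0..N}"]) (use vN in auto)
  let ?L = "{v \<in> range ?v. v \<le> a}" and ?U = "{v \<in> range ?v. a \<le> v}"
  \<comment> \<open>The constants guarantee an old value on each side of \<open>a\<close>.\<close>
  have "?v MinC \<in> ?L" "?v MaxC \<in> ?U"
    using a rangeI[of ?v MinC] rangeI[of ?v MaxC] by simp_all
  then have nonempty: "?L \<noteq> {}" "?U \<noteq> {}" by (metis empty_iff)+
  have "Max ?L \<in> ?L" by (rule Max_in[OF fin nonempty(1)])
  moreover have "Min ?U \<in> ?U" by (rule Min_in[OF fin nonempty(2)])
  ultimately obtain s t where s: "?v s \<le> a" "Max ?L = ?v s" and t: "a \<le> ?v t" "Min ?U = ?v t"
    by fastforce
  have gap: "?v r \<le> ?v s \<or> ?v t \<le> ?v r" for r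
  proof (cases "?v r \<le> a")
    case True
    then have "?v r \<le> Max ?L" by (intro Max_ge fin) simp
    then show ?thesis unfolding s(2) ..
  next
    case False
    then have "Min ?U \<le> ?v r" by (intro Min_le fin) simp
    then show ?thesis unfolding t(2) ..
  qed
  \<comment> \<open>The truncated difference \<open>?v s - ?v t\<close> is 0, and a positive cap
    carries this over to \<open>?w\<close>.\<close>
  have "?w s \<le> ?w t" using same'[of s t] K s(1) t(1) by linarith
  then obtain b where b: "?w s \<le> b" "b \<le> ?w t" "min K (a - ?v s) = min K (b - ?w s)"
    "min K (?v t - a) = min K (?w t - b)"
    using split_capped_interval[OF s(1) t(1) same'] by blast
  \<comment> \<open>Every old value is reached from the new point through \<open>s\<close> or
    \<open>t\<close>, so its capped distance is a capped sum.\<close>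
  have new: "min K (a - ?v r) = min K (b - ?w r) \<and> min K (?v r - a) = min K (?w r - b)" for r
    using gap[of r]
  proof
    assume r: "?v r \<le> ?v s"
    then have r': "?w r \<le> ?w s" using same'[of r s] K by simp
    have "min K ((a - ?v s) + (?v s - ?v r)) = min K ((b - ?w s) + (?w s - ?w r))"
      using capped_add[OF b(3)] same'[of s r] by simp
    then show ?thesis using r r' s(1) b(1) by simp
  next
    assume r: "?v t \<le> ?v r"
    then have r': "?w t \<le> ?w r" using same'[of t r] K by simp
    have "min K ((?v t - a) + (?v r - ?v t)) = min K ((?w t - b) + (?w r - ?w t))"
      using capped_add[OF b(4)] same'[of r t] by simp
    then show ?thesis using r r' t(1) b(2) by simp
  qed
  have old: "min K (?v t - ?v s) = min K (?w t - ?w s)" for s t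
    using same'[of t s] by linarith
  have upd: "term_val (lin_ord N) (e(x := a)) r = (if r = Var x then a else ?v r)"
    "term_val (lin_ord M) (f(x := b)) r = (if r = Var x then b else ?w r)" for r
    by (cases r; simp)+
  have "same_capped_diffs K N M (e(x := a)) (f(x := b))"
    unfolding same_capped_diffs_def upd using new old by simp
  moreover have "b \<le> M" using b(2) wM[of t] by linarith
  ultimately show ?thesis by blast
qed

lemma range_fun_upd_subset:
  assumes "range e \<subseteq> A" "a \<in> A"
  shows "range (e(x := a)) \<subseteq> A"
  using assms by auto

text \<open>Each nested quantifier halves the cap, so \<open>2 ^ k\<close> lasts for
  \<open>k\<close> rounds. At the atoms the cap is still at least 1, which decides equality and
  order.\<close>

lemma sat_iff_same_capped_diffs:
  assumes "quantifier_rank p \<le> k" "same_capped_diffs (2 ^ k) N M e f"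
    "range e \<subseteq> {0..N}" "range f \<subseteq> {0..M}"
  shows "sat (lin_ord N) e p \<longleftrightarrow> sat (lin_ord M) f p"
  using assms
proof (induction p arbitrary: k e f)
  case (Eq s t)
  have "min (2 ^ k) (term_val (lin_ord N) e t - term_val (lin_ord N) e s)
      = min (2 ^ k) (term_val (lin_ord M) f t - term_val (lin_ord M) f s)"
    "min (2 ^ k) (term_val (lin_ord N) e s - term_val (lin_ord N) e t)
      = min (2 ^ k) (term_val (lin_ord M) f s - term_val (lin_ord M) f t)" "(2::nat) ^ k \<ge> 1"
    using Eq.prems(2) unfolding same_capped_diffs_def by simp_all
  then show ?case unfolding sat.simps by linarith
next
  case (Lt s t)
  have "min (2 ^ k) (term_val (lin_ord N) e t - term_val (lin_ord N) e s)
      = min (2 ^ k) (term_val (lin_ord M) f t - term_val (lin_ord M) f s)" "(2::nat) ^ k \<ge> 1"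
    using Lt.prems(2) unfolding same_capped_diffs_def by simp_all
  then show ?case unfolding sat.simps lt_rel_lin_ord by linarith
next
  case (Neg p)
  then show ?case by simp
next
  case (Conj p q)
  then have "sat (lin_ord N) e p \<longleftrightarrow> sat (lin_ord M) f p" "sat (lin_ord N) e q \<longleftrightarrow> sat (lin_ord M) f q"
    using Conj.IH(1)[of k e f] Conj.IH(2)[of k e f] by simp_all
  then show ?case by simp
next
  case (Disj p q)
  then have "sat (lin_ord N) e p \<longleftrightarrow> sat (lin_ord M) f p" "sat (lin_ord N) e q \<longleftrightarrow> sat (lin_ord M) f q"
    using Disj.IH(1)[of k e f] Disj.IH(2)[of k e f] by simp_all
  then show ?case by simp
next
  case (Imp p q)
  then have "sat (lin_ord N) e p \<longleftrightarrow> sat (lin_ord M) f p" "sat (lin_ord N) e q \<longleftrightarrow> sat (lin_ord M) f q"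
    using Imp.IH(1)[of k e f] Imp.IH(2)[of k e f] by simp_all
  then show ?case by simp
next
  case (Ex x p)
  then obtain j where k: "k = Suc j" and j: "quantifier_rank p \<le> j" by (cases k) auto
  have same: "same_capped_diffs (2 * 2 ^ j) N M e f" using Ex.prems(2) k by simp
  have "\<exists>b\<in>{0..M}. sat (lin_ord M) (f(x := b)) p"
    if a: "a \<in> {0..N}" "sat (lin_ord N) (e(x := a)) p" for a
  proof -
    obtain b where "b \<le> M" "same_capped_diffs (2 ^ j) N M (e(x := a)) (f(x := b))"
      using same_capped_diffs_extend[OF _ same Ex.prems(3,4)] a(1) by auto
    then show ?thesis
      using Ex.IH[OF j _ range_fun_upd_subset range_fun_upd_subset] Ex.prems(3,4) a by fastforce
  qed
  moreover have "\<exists>a\<in>{0..N}. sat (lin_ord N) (e(x := a)) p"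
    if b: "b \<in> {0..M}" "sat (lin_ord M) (f(x := b)) p" for b
  proof -
    obtain a where "a \<le> N" "same_capped_diffs (2 ^ j) N M (e(x := a)) (f(x := b))"
      using same_capped_diffs_extend[OF _ same_capped_diffs_sym[OF same] Ex.prems(4,3)] b(1)
        same_capped_diffs_sym by fastforce
    then show ?thesis
      using Ex.IH[OF j _ range_fun_upd_subset range_fun_upd_subset] Ex.prems(3,4) b by fastforce
  qed
  ultimately show ?case by auto
next
  case (All x p)
  then obtain j where k: "k = Suc j" and j: "quantifier_rank p \<le> j" by (cases k) auto
  have same: "same_capped_diffs (2 * 2 ^ j) N M e f" using All.prems(2) k by simp
  \<comment> \<open>Dually to the existential case, counterexamples are transferred instead of
    witnesses.\<close>
  have "\<exists>b\<in>{0..M}. \<not> sat (lin_ord M) (f(x := b)) p"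
    if a: "a \<in> {0..N}" "\<not> sat (lin_ord N) (e(x := a)) p" for a
  proof -
    obtain b where "b \<le> M" "same_capped_diffs (2 ^ j) N M (e(x := a)) (f(x := b))"
      using same_capped_diffs_extend[OF _ same All.prems(3,4)] a(1) by auto
    then show ?thesis
      using All.IH[OF j _ range_fun_upd_subset range_fun_upd_subset] All.prems(3,4) a by fastforce
  qed
  moreover have "\<exists>a\<in>{0..N}. \<not> sat (lin_ord N) (e(x := a)) p"
    if b: "b \<in> {0..M}" "\<not> sat (lin_ord M) (f(x := b)) p" for b
  proof -
    obtain a where "a \<le> N" "same_capped_diffs (2 ^ j) N M (e(x := a)) (f(x := b))"
      using same_capped_diffs_extend[OF _ same_capped_diffs_sym[OF same] All.prems(4,3)] b(1)
        same_capped_diffs_sym by fastforce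
    then show ?thesis
      using All.IH[OF j _ range_fun_upd_subset range_fun_upd_subset] All.prems(3,4) b by fastforce
  qed
  ultimately show ?case by (metis sat.simps(8) universe_lin_ord)
qed

text \<open>Otherwise \<open>p\<close> could not tell \<open>lin_ord l\<close> from
  \<open>lin_ord (Suc l)\<close>: under the constant assignment 0 all terms denote end points, and
  both lengths reach the cap.\<close>

lemma separates_imp_less_power_rank:
  assumes "l \<ge> 1" "sentence p" "separates p (lin_ords_upto l) (lin_ords_above l)"
  shows "l < 2 ^ quantifier_rank p"
proof (rule ccontr)
  assume "\<not> l < 2 ^ quantifier_rank p"
  then have ge: "2 ^ quantifier_rank p \<le> l" by simp
  let ?e = "\<lambda>_. 0 :: nat"
  have "lin_ord l \<in> lin_ords_upto l" "lin_ord (Suc l) \<in> lin_ords_above l"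
    using assms(1) unfolding lin_ords_upto_def lin_ords_above_def by auto
  then have "sat (lin_ord l) ?e p" "\<not> sat (lin_ord (Suc l)) ?e p"
    using assms(2,3) holds_in_sentence[of p ?e] unfolding separates_def by auto
  moreover have "same_capped_diffs (2 ^ quantifier_rank p) l (Suc l) ?e ?e"
    unfolding same_capped_diffs_def
  proof (intro allI)
    fix s t
    show "min (2 ^ quantifier_rank p) (term_val (lin_ord l) ?e t - term_val (lin_ord l) ?e s)
      = min (2 ^ quantifier_rank p) (term_val (lin_ord (Suc l)) ?e t - term_val (lin_ord (Suc l)) ?e s)"
      using ge by (cases s; cases t; simp)
  qed
  ultimately show False using sat_iff_same_capped_diffs[OF order_refl] by auto
qed

section \<open>Prenex formulas over a fixed quantifier prefix\<close>

text \<open>The prefix binds the variables from \<open>n\<close> upwards, so the variables below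
  \<open>n\<close> are parameters that it cannot capture.\<close>

fun prenex :: "nat \<Rightarrow> bool list \<Rightarrow> ord_fm \<Rightarrow> ord_fm" where
  "prenex n [] p = p"
| "prenex n (q # Qs) p = (if q then Ex else All) n (prenex (Suc n) Qs p)"

text \<open>The prefix is given and only the quantifier-free matrix may be chosen, uniformly in
  \<open>N\<close> and \<open>e\<close>. Conditions over the same prefix can thus be combined
  without further quantifiers.\<close>

definition expressible :: "bool list \<Rightarrow> nat \<Rightarrow> (nat \<Rightarrow> (nat \<Rightarrow> nat) \<Rightarrow> bool) \<Rightarrow> bool" where
  "expressible Qs n P \<longleftrightarrow> (\<exists>p. quantifier_count p = 0 \<and> free_vars p \<subseteq> {..<n + length Qs} \<and>
     (\<forall>N e. range e \<subseteq> {0..N} \<longrightarrow> sat (lin_ord N) e (prenex n Qs p) = P N e))"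

lemma quantifier_count_prenex:
  "quantifier_count (prenex n Qs p) = length Qs + quantifier_count p"
  by (induction Qs arbitrary: n) auto

lemma free_vars_prenex:
  "free_vars (prenex n Qs p) = free_vars p - {n..<n + length Qs}"
  by (induction Qs arbitrary: n) auto

lemma expressible_qf:
  assumes "quantifier_count p = 0" "free_vars p \<subseteq> {..<n}"
  shows "expressible [] n (\<lambda>N e. sat (lin_ord N) e p)"
  using assms unfolding expressible_def by auto

text \<open>Vacuous quantifiers are harmless because every universe is nonempty. This pads branches
  that are already decided to the common prefix.\<close>

lemma expressible_const: "expressible Qs n (\<lambda>N e. b)"
proof -
  let ?p = "if b then Eq MinC MinC else Neg (Eq MinC MinC)"
  have "sat (lin_ord N) e (prenex n Qs ?p) = b" for N e
  proof (induction Qs arbitrary: n e)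
    case (Cons q Qs)
    then show ?case by (cases q) auto
  qed simp
  then show ?thesis unfolding expressible_def by (intro exI[of _ ?p]) simp
qed

lemma expressible_Ex:
  assumes "expressible Qs (Suc n) P"
  shows "expressible (True # Qs) n (\<lambda>N e. \<exists>a\<le>N. P N (e(n := a)))"
proof -
  obtain p where "quantifier_count p = 0" "free_vars p \<subseteq> {..<Suc n + length Qs}"
    and p: "\<And>N e. range e \<subseteq> {0..N} \<Longrightarrow> sat (lin_ord N) e (prenex (Suc n) Qs p) = P N e"
    using assms unfolding expressible_def by blast
  moreover have "sat (lin_ord N) e (prenex n (True # Qs) p) = (\<exists>a\<le>N. P N (e(n := a)))"
    if "range e \<subseteq> {0..N}" for N e
    using p[OF range_fun_upd_subset[OF that]] by auto
  ultimately show ?thesis unfolding expressible_def by (intro exI[of _ p]) simp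
qed

lemma expressible_All:
  assumes "expressible Qs (Suc n) P"
  shows "expressible (False # Qs) n (\<lambda>N e. \<forall>a\<le>N. P N (e(n := a)))"
proof -
  obtain p where "quantifier_count p = 0" "free_vars p \<subseteq> {..<Suc n + length Qs}"
    and p: "\<And>N e. range e \<subseteq> {0..N} \<Longrightarrow> sat (lin_ord N) e (prenex (Suc n) Qs p) = P N e"
    using assms unfolding expressible_def by blast
  moreover have "sat (lin_ord N) e (prenex n (False # Qs) p) = (\<forall>a\<le>N. P N (e(n := a)))"
    if "range e \<subseteq> {0..N}" for N e
    using p[OF range_fun_upd_subset[OF that]] by auto
  ultimately show ?thesis unfolding expressible_def by (intro exI[of _ p]) simp
qed

text \<open>The prefix does not bind any variable of \<open>c\<close>, so the truth value of
  \<open>c\<close> is fixed throughout and the matrix collapses to \<open>p\<close> or to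
  \<open>q\<close>.\<close>

lemma sat_prenex_if:
  assumes "free_vars c \<subseteq> {..<n}"
  shows "sat S e (prenex n Qs (Conj (Imp c p) (Disj c q))) =
    (if sat S e c then sat S e (prenex n Qs p) else sat S e (prenex n Qs q))"
  using assms
proof (induction Qs arbitrary: n e)
  case Nil
  then show ?case by simp
next
  case (Cons b Qs)
  have "sat S (e(n := a)) c = sat S e c" for a
    by (rule sat_cong) (use Cons.prems in auto)
  moreover have "free_vars c \<subseteq> {..<Suc n}" using Cons.prems by auto
  ultimately show ?case using Cons.IH[of "Suc n"] by simp
qed

text \<open>This is where quantifiers are saved: a case distinction on a quantifier-free condition
  lets two formulas share one prefix, whereas a plain Boolean combination would add up their
  counts.\<close>

lemma expressible_if:
  assumes "quantifier_count c = 0" "free_vars c \<subseteq> {..<n}"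
    and "expressible Qs n P" "expressible Qs n Q"
  shows "expressible Qs n (\<lambda>N e. if sat (lin_ord N) e c then P N e else Q N e)"
proof -
  obtain p q where pq: "quantifier_count p = 0" "free_vars p \<subseteq> {..<n + length Qs}"
      "quantifier_count q = 0" "free_vars q \<subseteq> {..<n + length Qs}"
      and p: "\<And>N e. range e \<subseteq> {0..N} \<Longrightarrow> sat (lin_ord N) e (prenex n Qs p) = P N e"
      and q: "\<And>N e. range e \<subseteq> {0..N} \<Longrightarrow> sat (lin_ord N) e (prenex n Qs q) = Q N e"
    using assms(3,4) unfolding expressible_def by blast
  let ?r = "Conj (Imp c p) (Disj c q)"
  have "sat (lin_ord N) e (prenex n Qs ?r) = (if sat (lin_ord N) e c then P N e else Q N e)"
    if "range e \<subseteq> {0..N}" for N e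
    unfolding sat_prenex_if[OF assms(2)] p[OF that] q[OF that] ..
  moreover have "quantifier_count ?r = 0" "free_vars ?r \<subseteq> {..<n + length Qs}"
    using pq assms(1,2) by auto
  ultimately show ?thesis unfolding expressible_def by blast
qed

section \<open>Bounding the lengths of intervals\<close>

definition both_short :: "ord_term \<Rightarrow> ord_term \<Rightarrow> ord_term \<Rightarrow> nat \<Rightarrow> nat \<Rightarrow> nat \<Rightarrow> (nat \<Rightarrow> nat) \<Rightarrow> bool" where
  "both_short s t u a b N e \<longleftrightarrow> (let v = term_val (lin_ord N) e in
     v s \<le> v t \<and> v t \<le> v u \<and> v t \<le> v s + a \<and> v u \<le> v t + b)"

text \<open>The middle point lies in a half-open interval, so that a point falls into at most one of
  two consecutive intervals. The bounds are strict, so a bound of 0 switches the corresponding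
  alternative off.\<close>

definition one_short :: "ord_term \<Rightarrow> ord_term \<Rightarrow> ord_term \<Rightarrow> nat \<Rightarrow> nat \<Rightarrow> nat \<Rightarrow> (nat \<Rightarrow> nat) \<Rightarrow> bool" where
  "one_short s t u a b N e \<longleftrightarrow> (let v = term_val (lin_ord N) e in
     v s \<le> v t \<and> v t < v u \<and> (v t < v s + a \<or> v u < v t + b))"

text \<open>One prefix has to serve all terms and all bounds up to \<open>m\<close>, since instances
  for different intervals are merged under it.\<close>

definition expresses_both_short :: "bool list \<Rightarrow> nat \<Rightarrow> bool" where
  "expresses_both_short Qs m \<longleftrightarrow> (\<forall>n s t u a b.
     term_vars s \<union> term_vars t \<union> term_vars u \<subseteq> {..<n} \<longrightarrow> a \<le> m \<longrightarrow> b \<le> m \<longrightarrow>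
     expressible Qs n (both_short s t u a b))"

definition expresses_one_short :: "bool list \<Rightarrow> nat \<Rightarrow> bool" where
  "expresses_one_short Qs m \<longleftrightarrow> (\<forall>n s t u a b.
     term_vars s \<union> term_vars t \<union> term_vars u \<subseteq> {..<n} \<longrightarrow> a \<le> m \<longrightarrow> b \<le> m \<longrightarrow>
     expressible Qs n (one_short s t u a b))"

lemma term_val_fresh:
  assumes "term_vars t \<subseteq> {..<n}"
  shows "term_val S (e(n := a)) t = term_val S e t"
  by (rule term_val_cong) (use assms in auto)

lemma expressible_cong:
  assumes "expressible Qs n P" "\<And>N e. range e \<subseteq> {0..N} \<Longrightarrow> P N e = Q N e"
  shows "expressible Qs n Q"
  using assms unfolding expressible_def by simp

text \<open>With bounds at most 1 the second alternative contradicts \<open>t\<close> lying strictly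
  below \<open>u\<close>, and the first one says that \<open>a\<close> is 1 and \<open>s\<close>
  equals \<open>t\<close>.\<close>

lemma expresses_one_short_Nil: "expresses_one_short [] 1"
  unfolding expresses_one_short_def
proof (intro allI impI)
  fix n s t u and a b :: nat
  assume vars: "term_vars s \<union> term_vars t \<union> term_vars u \<subseteq> {..<n}" and ab: "a \<le> 1" "b \<le> 1"
  let ?p = "Conj (Lt t u) (if a = 0 then Neg (Eq t t) else Eq s t)"
  have "expressible [] n (\<lambda>N e. sat (lin_ord N) e ?p)"
    using vars by (intro expressible_qf) auto
  then show "expressible [] n (one_short s t u a b)"
    by (rule expressible_cong) (use ab in \<open>auto simp: one_short_def Let_def\<close>)
qed

text \<open>The two bounds add up to \<open>a + 1\<close>, so a point violating both exists exactly
  when the interval is longer than \<open>a\<close>; \<open>x + (a + 1) div 2\<close> is then such a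
  point.\<close>

lemma all_one_short_iff:
  fixes x w N a :: nat
  assumes "w \<le> N"
  shows "(\<forall>u\<le>N. x \<le> u \<longrightarrow> u < w \<longrightarrow> u < x + (a + 1) div 2 \<or> w < u + (a + 2) div 2)
    \<longleftrightarrow> w \<le> x + a"
proof
  assume *: "\<forall>u\<le>N. x \<le> u \<longrightarrow> u < w \<longrightarrow> u < x + (a + 1) div 2 \<or> w < u + (a + 2) div 2"
  show "w \<le> x + a"
  proof (rule ccontr)
    assume "\<not> w \<le> x + a"
    then show False using *[rule_format, of "x + (a + 1) div 2"] assms by linarith
  qed
next
  assume "w \<le> x + a"
  then show "\<forall>u\<le>N. x \<le> u \<longrightarrow> u < w \<longrightarrow> u < x + (a + 1) div 2 \<or> w < u + (a + 2) div 2"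
    by (intro allI impI) linarith
qed

text \<open>The universal point tests whichever interval it falls into, and letting it range over
  all points tests both intervals. The bound \<open>2 * m - 1\<close> is the largest
  \<open>a\<close> for which \<open>(a + 2) div 2\<close> is at most \<open>m\<close>.\<close>

lemma expresses_both_short_Cons:
  assumes "expresses_one_short Qs m" "m \<ge> 1"
  shows "expresses_both_short (False # Qs) (2 * m - 1)"
  unfolding expresses_both_short_def
proof (intro allI impI)
  fix n s t u and a b :: nat
  assume vars: "term_vars s \<union> term_vars t \<union> term_vars u \<subseteq> {..<n}"
    and a: "a \<le> 2 * m - 1" and b: "b \<le> 2 * m - 1"
  show "expressible (False # Qs) n (both_short s t u a b)"
  proof -
    let ?z = "Var n"
    have one: "expressible Qs (Suc n) (one_short s ?z t ((a + 1) div 2) ((a + 2) div 2))"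
       "expressible Qs (Suc n) (one_short t ?z u ((b + 1) div 2) ((b + 2) div 2))"
      by (rule assms(1)[unfolded expresses_one_short_def, rule_format];
        use vars a b assms(2) in \<open>auto\<close>)+
    let ?c1 = "Disj (Lt t s) (Lt u t)" and ?c2 = "Conj (Neg (Lt ?z s)) (Lt ?z t)"
      and ?c3 = "Conj (Neg (Lt ?z t)) (Lt ?z u)"
    \<comment> \<open>A point outside both intervals imposes no condition, hence the final
      \<open>True\<close>.\<close>
    let ?R = "\<lambda>N e. if sat (lin_ord N) e ?c1 then False
       else if sat (lin_ord N) e ?c2 then one_short s ?z t ((a + 1) div 2) ((a + 2) div 2) N e
       else if sat (lin_ord N) e ?c3 then one_short t ?z u ((b + 1) div 2) ((b + 2) div 2) N e
       else True"
    have "expressible Qs (Suc n) ?R"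
      by (intro expressible_if expressible_const one) (use vars in auto)
    then have "expressible (False # Qs) n (\<lambda>N e. \<forall>a\<le>N. ?R N (e(n := a)))"
      by (rule expressible_All)
    then show ?thesis
    proof (rule expressible_cong)
      fix N and e :: "nat \<Rightarrow> nat"
      assume e: "range e \<subseteq> {0..N}"
      let ?v = "term_val (lin_ord N) e"
      have fresh: "term_val (lin_ord N) (e(n := c)) s = ?v s"
        "term_val (lin_ord N) (e(n := c)) t = ?v t" "term_val (lin_ord N) (e(n := c)) u = ?v u" for c
        by (rule term_val_fresh; use vars in \<open>simp\<close>)+
      note iff = all_one_short_iff[OF term_val_le[OF e], of "?v s" t a]
        all_one_short_iff[OF term_val_le[OF e], of "?v t" u b]
      show "(\<forall>a\<le>N. ?R N (e(n := a))) = both_short s t u a b N e"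
      proof (cases "?v s \<le> ?v t \<and> ?v t \<le> ?v u")
        case False
        then have "sat (lin_ord N) (e(n := z)) ?c1" for z by (auto simp: fresh)
        then have "\<not> ?R N (e(n := 0))" by metis
        moreover have "\<not> both_short s t u a b N e" using False unfolding both_short_def Let_def by blast
        ultimately show ?thesis by blast
      next
        case True
        \<comment> \<open>With the terms in order the cases exclude each other, so \<open>?R\<close>
          is a conjunction of two implications and the universal quantifier distributes over
          it.\<close>
        have "?R N (e(n := z)) \<longleftrightarrow>
          (?v s \<le> z \<longrightarrow> z < ?v t \<longrightarrow> z < ?v s + (a + 1) div 2 \<or> ?v t < z + (a + 2) div 2) \<and>
          (?v t \<le> z \<longrightarrow> z < ?v u \<longrightarrow> z < ?v t + (b + 1) div 2 \<or> ?v u < z + (b + 2) div 2)" for z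
          using True by (simp add: one_short_def Let_def fresh not_less) (blast dest: leD)
        then have "(\<forall>a\<le>N. ?R N (e(n := a))) \<longleftrightarrow> ?v t \<le> ?v s + a \<and> ?v u \<le> ?v t + b"
          unfolding iff[symmetric] by blast
        with True show ?thesis by (simp only: both_short_def Let_def simp_thms)
      qed
    qed
  qed
qed

text \<open>For positive \<open>a\<close> the bounds on the two halves add up to
  \<open>a - 1\<close>. The witness goes as far right as its first bound and \<open>w\<close>
  permit.\<close>

lemma ex_both_short_iff:
  fixes x w a :: nat
  assumes "x < w" "w \<le> N"
  shows "(\<exists>z\<le>N. x < z \<and> z \<le> w \<and> z \<le> x + a div 2 \<and> w \<le> z + (a - 1) div 2) \<longleftrightarrow> w < x + a"
proof
  assume "w < x + a"
  with assms show "\<exists>z\<le>N. x < z \<and> z \<le> w \<and> z \<le> x + a div 2 \<and> w \<le> z + (a - 1) div 2"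
    by (intro exI[of _ "min w (x + a div 2)"]) linarith
next
  assume "\<exists>z\<le>N. x < z \<and> z \<le> w \<and> z \<le> x + a div 2 \<and> w \<le> z + (a - 1) div 2"
  then obtain z where "x < z" "z \<le> x + a div 2" "w \<le> z + (a - 1) div 2" by blast
  then show "w < x + a" by linarith
qed

text \<open>This variant admits \<open>z = x\<close>, because the left interval may be degenerate.
  For \<open>a = 0\<close> the choice \<open>z = x = w\<close> would satisfy the left side
  wrongly.\<close>

lemma ex_both_short_iff':
  fixes x w a :: nat
  assumes "x \<le> w" "w \<le> N" "a > 0"
  shows "(\<exists>z\<le>N. x \<le> z \<and> z \<le> w \<and> z \<le> x + a div 2 \<and> w \<le> z + (a - 1) div 2) \<longleftrightarrow> w < x + a"
proof
  assume "w < x + a"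
  with assms show "\<exists>z\<le>N. x \<le> z \<and> z \<le> w \<and> z \<le> x + a div 2 \<and> w \<le> z + (a - 1) div 2"
    by (intro exI[of _ "min w (x + a div 2)"]) linarith
next
  assume "\<exists>z\<le>N. x \<le> z \<and> z \<le> w \<and> z \<le> x + a div 2 \<and> w \<le> z + (a - 1) div 2"
  then obtain z where "x \<le> z" "z \<le> x + a div 2" "w \<le> z + (a - 1) div 2" by blast
  then show "w < x + a" using assms(3) by linarith
qed

text \<open>The position of the existential point chooses the interval claimed to be short, and the
  point splits that interval into two short parts. The bound \<open>2 * m + 1\<close> is the largest
  \<open>a\<close> for which both \<open>a div 2\<close> and \<open>(a - 1) div 2\<close> are at
  most \<open>m\<close>.\<close>

lemma expresses_one_short_Cons:
  assumes "expresses_both_short Qs m"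
  shows "expresses_one_short (True # Qs) (2 * m + 1)"
  unfolding expresses_one_short_def
proof (intro allI impI)
  fix n s t u and a b :: nat
  assume vars: "term_vars s \<union> term_vars t \<union> term_vars u \<subseteq> {..<n}"
    and a: "a \<le> 2 * m + 1" and b: "b \<le> 2 * m + 1"
  let ?z = "Var n"
  have both: "expressible Qs (Suc n) (both_short s ?z t (a div 2) ((a - 1) div 2))"
     "expressible Qs (Suc n) (both_short t ?z u (b div 2) ((b - 1) div 2))"
    by (rule assms[unfolded expresses_both_short_def, rule_format]; use vars a b in \<open>auto\<close>)+
  let ?c1 = "Disj (Lt t s) (Neg (Lt t u))" and ?c2 = "Conj (Neg (Lt ?z s)) (Neg (Lt t ?z))"
    and ?c3 = "Conj (Lt t ?z) (Neg (Lt u ?z))"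
  text \<open>With \<open>a = 0\<close> the bounds on the two halves would truncate to \<open>0\<close> instead of adding up to \<open>-1\<close>.\<close>
  let ?c2' = "if a = 0 then Lt s s else ?c2"
  let ?R = "\<lambda>N e. if sat (lin_ord N) e ?c1 then False
     else if sat (lin_ord N) e ?c2' then both_short s ?z t (a div 2) ((a - 1) div 2) N e
     else if sat (lin_ord N) e ?c3 then both_short t ?z u (b div 2) ((b - 1) div 2) N e
     else False"
  have "expressible Qs (Suc n) ?R"
    by (intro expressible_if expressible_const both) (use vars in auto)
  then have "expressible (True # Qs) n (\<lambda>N e. \<exists>a\<le>N. ?R N (e(n := a)))"
    by (rule expressible_Ex)
  then show "expressible (True # Qs) n (one_short s t u a b)"
  proof (rule expressible_cong)
    fix N and e :: "nat \<Rightarrow> nat"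
    assume e: "range e \<subseteq> {0..N}"
    let ?v = "term_val (lin_ord N) e"
    have fresh: "term_val (lin_ord N) (e(n := c)) s = ?v s"
      "term_val (lin_ord N) (e(n := c)) t = ?v t" "term_val (lin_ord N) (e(n := c)) u = ?v u" for c
      by (rule term_val_fresh; use vars in \<open>simp\<close>)+
    show "(\<exists>a\<le>N. ?R N (e(n := a))) = one_short s t u a b N e"
    proof (cases "?v s \<le> ?v t \<and> ?v t < ?v u")
      case False
      then show ?thesis by (auto simp: one_short_def Let_def fresh)
    next
      case True
      have R: "?R N (e(n := z)) \<longleftrightarrow>
        a > 0 \<and> (?v s \<le> z \<and> z \<le> ?v t \<and> z \<le> ?v s + a div 2 \<and> ?v t \<le> z + (a - 1) div 2) \<or>
        (?v t < z \<and> z \<le> ?v u \<and> z \<le> ?v t + b div 2 \<and> ?v u \<le> z + (b - 1) div 2)" for z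
        using True by (simp add: both_short_def Let_def fresh not_less)
      have "(\<exists>a\<le>N. ?R N (e(n := a))) \<longleftrightarrow>
        a > 0 \<and> (\<exists>z\<le>N. ?v s \<le> z \<and> z \<le> ?v t \<and> z \<le> ?v s + a div 2 \<and> ?v t \<le> z + (a - 1) div 2) \<or>
        (\<exists>z\<le>N. ?v t < z \<and> z \<le> ?v u \<and> z \<le> ?v t + b div 2 \<and> ?v u \<le> z + (b - 1) div 2)"
        unfolding R by blast
      also have "\<dots> \<longleftrightarrow> a > 0 \<and> ?v t < ?v s + a \<or> ?v u < ?v t + b"
        using True ex_both_short_iff[OF _ term_val_le[OF e], of "?v t" u b]
          ex_both_short_iff'[OF _ term_val_le[OF e], of "?v s" t a] by metis
      also have "\<dots> \<longleftrightarrow> ?v t < ?v s + a \<or> ?v u < ?v t + b"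
        using True by (cases a) simp_all
      finally show ?thesis using True by (simp only: one_short_def Let_def simp_thms)
    qed
  qed
qed

text \<open>A universal quantifier in front of an existential one takes the bound \<open>m\<close>
  to \<open>2 * (2 * m + 1) - 1 = 4 * m + 1\<close>, which is weakened to
  \<open>4 * m\<close>.\<close>

lemma expresses_both_short_power:
  "\<exists>Qs. length Qs = 2 * j + 1 \<and> expresses_both_short Qs (4 ^ j)"
proof (induction j)
  case 0
  show ?case using expresses_both_short_Cons[OF expresses_one_short_Nil]
    by (intro exI[of _ "[False]"]) simp
next
  case (Suc j)
  then obtain Qs where "length Qs = 2 * j + 1" "expresses_both_short Qs (4 ^ j)" by blast
  moreover from expresses_both_short_Cons[OF expresses_one_short_Cons[OF this(2)]]
  have "expresses_both_short (False # True # Qs) (4 ^ Suc j)"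
    unfolding expresses_both_short_def by simp
  ultimately show ?case by (intro exI[of _ "False # True # Qs"]) simp
qed

section \<open>Separating sentences and the comparison of the two minima\<close>

lemma separating_sentence_of_expressible:
  assumes "expressible Qs 0 P" "\<And>N e. N \<ge> 1 \<Longrightarrow> P N e \<longleftrightarrow> N \<le> l"
  shows "\<exists>p. sentence p \<and> separates p (lin_ords_upto l) (lin_ords_above l)
    \<and> quantifier_count p = length Qs"
proof -
  obtain p where p: "quantifier_count p = 0" "free_vars p \<subseteq> {..<length Qs}"
    "\<And>N e. range e \<subseteq> {0..N} \<Longrightarrow> sat (lin_ord N) e (prenex 0 Qs p) = P N e"
    using assms(1) unfolding expressible_def by auto
  have sentence: "sentence (prenex 0 Qs p)"
    using p(2) unfolding sentence_def free_vars_prenex by auto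
  have "holds_in (lin_ord N) (prenex 0 Qs p) \<longleftrightarrow> N \<le> l" if "N \<ge> 1" for N
    using holds_in_sentence[OF sentence, of "\<lambda>_. 0" "lin_ord N"] p(3)[of "\<lambda>_. 0" N] assms(2)[OF that]
    by auto
  then have "separates (prenex 0 Qs p) (lin_ords_upto l) (lin_ords_above l)"
    unfolding separates_def lin_ords_upto_def lin_ords_above_def by auto
  with sentence p(1) show ?thesis by (auto simp: quantifier_count_prenex)
qed

text \<open>The parity of \<open>k\<close> decides the leading quantifier: for even \<open>k\<close>
  the prefix starts universally and reaches \<open>4 ^ j = 2 ^ k\<close>; for odd \<open>k\<close>
  one more existential quantifier is put in front, with bound
  \<open>2 * 4 ^ j + 1 = 2 ^ k + 1\<close>.\<close>

lemma ex_separating_sentence: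
  assumes "l \<ge> 1" "l < 2 ^ k"
  shows "\<exists>p. sentence p \<and> separates p (lin_ords_upto l) (lin_ords_above l)
    \<and> quantifier_count p = k + 1"
proof (cases "even k")
  case True
  then obtain j where k: "k = 2 * j" by blast
  obtain Qs where Qs: "length Qs = 2 * j + 1" "expresses_both_short Qs (4 ^ j)"
    using expresses_both_short_power by blast
  have "l \<le> 4 ^ j" using assms(2) by (simp add: k power_mult)
  \<comment> \<open>The second interval is degenerate, so the condition only bounds the whole order
    by \<open>l\<close>.\<close>
  then have "expressible Qs 0 (both_short MinC MaxC MaxC l 0)"
    using Qs(2) unfolding expresses_both_short_def by simp
  from separating_sentence_of_expressible[OF this, of l] show ?thesis
    using Qs(1) k by (simp add: both_short_def)
next
  case False
  then obtain j where k: "k = 2 * j + 1" by (blast elim: oddE)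
  obtain Qs where Qs: "length Qs = 2 * j + 1" "expresses_both_short Qs (4 ^ j)"
    using expresses_both_short_power by blast
  have "l + 1 \<le> 2 * 4 ^ j + 1" using assms(2) by (simp add: k power_mult)
  \<comment> \<open>The bound 0 disables the degenerate first interval, and the strict bound
    \<open>l + 1\<close> on the second one means length at most \<open>l\<close>.\<close>
  then have "expressible (True # Qs) 0 (one_short MinC MinC MaxC 0 (l + 1))"
    using expresses_one_short_Cons[OF Qs(2)] unfolding expresses_one_short_def by simp
  from separating_sentence_of_expressible[OF this, of l] show ?thesis
    using Qs(1) k by (simp add: one_short_def less_Suc_eq_le)
qed

lemma quantifier_rank_le_count: "quantifier_rank p \<le> quantifier_count p"
  by (induction p) auto

theorem theorem4p5:
  fixes l :: nat
  assumes "l \<ge> 1"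
  shows "min_rank l \<le> min_count l \<and> min_count l \<le> min_rank l + 1"
proof
  let ?sep = "\<lambda>p. sentence p \<and> separates p (lin_ords_upto l) (lin_ords_above l)"
  \<comment> \<open>The crude choice \<open>k = l\<close> suffices to make both minima
    attained.\<close>
  obtain p0 where "?sep p0"
    using ex_separating_sentence[OF assms less_exp] by blast
  then have ex: "\<exists>k p. ?sep p \<and> quantifier_count p = k" "\<exists>k p. ?sep p \<and> quantifier_rank p = k"
    by blast+
  obtain p where p: "?sep p" "quantifier_count p = min_count l"
    using LeastI_ex[OF ex(1)] unfolding min_count_def conj_assoc by blast
  have "min_rank l \<le> quantifier_rank p"
    unfolding min_rank_def by (rule Least_le) (use p(1) in blast)
  then show "min_rank l \<le> min_count l" using quantifier_rank_le_count[of p] p(2) by linarith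
  obtain q where q: "?sep q" "quantifier_rank q = min_rank l"
    using LeastI_ex[OF ex(2)] unfolding min_rank_def conj_assoc by blast
  then have "l < 2 ^ min_rank l" using separates_imp_less_power_rank[OF assms, of q] by simp
  from ex_separating_sentence[OF assms this] show "min_count l \<le> min_rank l + 1"
    unfolding min_count_def by (intro Least_le)
qed

end
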